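(* Let $f:\mathbb{R}^d\to\mathbb{R}$ be $m$-strongly convex and $M$-smooth ($m,M>0$), with (unique) minimizer $x^*\in\mathbb{R}^d$, and let $c>0$. Starting at $x_0\in\mathbb{R}^d$, after $k$ iterations of gradient descent with quasi-exact line search (described in the context), the iterates satisfy $$f(x_{k+1})-f(x^* )\ \le\ (f(x_1)-f(x^* ))\left(1-\frac{c}{c+1}\,\frac{m}{M}\right)^k.$$
   Context: A differentiable $f:\mathbb{R}^d\to\mathbb{R}$ is $m$-strongly convex if $f(x')\ge f(x)+\langle x'-x,\nabla f(x)\rangle+\frac m2\|x'-x\|_2^2$ for all $x,x'$, and $M$-smooth if $f(x')\le f(x)+\langle x'-x,\nabla f(x)\rangle+\frac M2\|x'-x\|_2^2$ for all $x,x'$. Gradient descent with quasi-exact line search and parameter $c$: set $x_1=x_0$ and $\alpha_{\text{prev}}=1$. For $k=1,2,\dots$: let $\tilde f(\alpha)=f(x_k-\alpha\nabla f(x_k))$ for $\alpha\ge0$; let $\alpha_c$ be the value returned by the procedure quasi_exact_line_search($\tilde f,c,\alpha_{\text{prev}}$), whose definition is given in the last paragraph of this context; set $x_{k+1}=x_k-\alpha_c\nabla f(x_k)$ and $\alpha_{\text{prev}}\leftarrow\alpha_c$. For a finite set $P$ of points on the graph of $\tilde f$, let $p^{\text{low}}(P)=(x^{\text{low}}(P),y^{\text{low}}(P))$ be a point of $P$ with smallest $y$-coordinate. For points $p^i=(x^i,y^i)$ and $p^j=(x^j,y^j)$ with $x^i\ne x^j$, let $f^{ij}(x)=\frac{y^i-y^j}{x^i-x^j}(x-x^i)+y^i$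 be the line through them. Define $$\Delta(P)=\Big\{(x,y)\in\mathbb{R}^2 :\ x\in\big[\min_{(x',y')\in P}x',\ \max_{(x',y')\in P}x'\big],\ \ y\le y^{\text{low}}(P),\ \ f^{ij}(x)\le y\ \text{ for all } p^i,p^j\in P \text{ with } x^i<x^j \text{ and } x\notin(x^i,x^j)\Big\},$$ $\Delta^x(P)=\{x : (x,y)\in\Delta(P)\text{ for some }y\}$, $\Delta^y(P)=\{y : (x,y)\in\Delta(P)\text{ for some }x\}$, and $|S|=\sup S-\inf S$ (possibly $\infty$). Core loop ($\Delta$-Secant_core), with fixed $\varepsilon\in(0,\frac12)$ and a stopping predicate: starting from a given finite set $Q_1$ of points on the graph of $\tilde f$, at iteration $t=1,2,\dots$: if the stopping predicate holds for $Q_t$, return $Q_t$. Otherwise let $x^-=\inf\Delta^x(Q_t)$, $x^+=\sup\Delta^x(Q_t)$, $x^m=(x^-+x^+)/2$; set $x^q=x^m+\varepsilon(x^+-x^-)$ if $x^m$ is already the abscissa of a point of $Q_t$, and $x^q=x^m$ otherwise; set $Q_{t+1}=Q_t\cup\{(x^q,\tilde f(x^q))\}$. Procedure quasi_exact_line_search($\tilde f,c,\alpha_{\text{prev}}$): the stopping predicate for a set $P$ is $c\,|\Delta^y(P)|\le\tilde f(0)-y^{\text{low}}(P)$. Start with $P_0=\{(0,\tilde f(0))\}$. For $i=0,1,2,\dots$: let $x^{\text{right}}=4^i\alpha_{\text{prev}}$ and $P_i'=P_i\cup\{(x^{\text{right}},\tilde f(x^{\text{right}}))\}$; let $P_{i+1}$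 be the output of the core loop started from $P_i'$ with the stopping predicate $c\,|\Delta^y(P)|\le\tilde f(0)-y^{\text{low}}(P)$; if $x^{\text{low}}(P_{i+1})<x^{\text{right}}$, return $x^{\text{low}}(P_{i+1})$; otherwise continue with the next $i$. "After $k$ iterations" means that the first $k$ line-search calls have returned. *)

theory Defs
  imports "HOL-Analysis.Analysis"
begin

definition grad :: "('a::real_inner \<Rightarrow> real) \<Rightarrow> 'a \<Rightarrow> 'a" where
  "grad f x = (THE g. GDERIV f x :> g)"

definition strongly_convex :: "real \<Rightarrow> ('a::real_inner \<Rightarrow> real) \<Rightarrow> bool" where
  "strongly_convex m f \<longleftrightarrow> (\<forall>x. f differentiable (at x)) \<and>
     (\<forall>x x'. f x' \<ge> f x + (x' - x) \<bullet> grad f x + m / 2 * (norm (x' - x))\<^sup>2)"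

definition smooth :: "real \<Rightarrow> ('a::real_inner \<Rightarrow> real) \<Rightarrow> bool" where
  "smooth M f \<longleftrightarrow> (\<forall>x. f differentiable (at x)) \<and>
     (\<forall>x x'. f x' \<le> f x + (x' - x) \<bullet> grad f x + M / 2 * (norm (x' - x))\<^sup>2)"

type_synonym point = "real \<times> real"

(* The lowest point itself need not be unique; it is kept as a predicate, so that ties may be
   broken arbitrarily, whereas its ordinate y_low is well defined. *)

definition is_low :: "point set \<Rightarrow> point \<Rightarrow> bool" where
  "is_low P p \<longleftrightarrow> is_arg_min snd (\<lambda>q. q \<in> P) p"

definition y_low :: "point set \<Rightarrow> real" where
  "y_low P = Min (snd ` P)"

definition secant :: "point \<Rightarrow> point \<Rightarrow> real \<Rightarrow> real" where
  "secant p q x = (snd p - snd q) / (fst p - fst q) * (x - fst p) + snd p"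

definition Delta :: "point set \<Rightarrow> point set" where
  "Delta P = {(x, y). x \<in> {Min (fst ` P)..Max (fst ` P)} \<and> y \<le> y_low P \<and>
     (\<forall>p\<in>P. \<forall>q\<in>P. fst p < fst q \<and> x \<notin> {fst p<..<fst q} \<longrightarrow> secant p q x \<le> y)}"

definition Delta_x :: "point set \<Rightarrow> real set" where
  "Delta_x P = {x. \<exists>y. (x, y) \<in> Delta P}"

definition Delta_y :: "point set \<Rightarrow> real set" where
  "Delta_y P = {y. \<exists>x. (x, y) \<in> Delta P}"

(* Extended real, because Delta_y P may be unbounded below. *)

definition extent :: "real set \<Rightarrow> ereal" where
  "extent S = (SUP s\<in>S. ereal s) - (INF s\<in>S. ereal s)"

definition next_query :: "real \<Rightarrow> point set \<Rightarrow> real" where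
  "next_query \<epsilon> Q =
     (let l = Inf (Delta_x Q); r = Sup (Delta_x Q); xm = (l + r) / 2
      in if xm \<in> fst ` Q then xm + \<epsilon> * (r - l) else xm)"

(* Both loops may fail to terminate, so they are modelled by input-output relations:
   secant_core g \<epsilon> stop Q R means that the loop started from Q returns R. *)

inductive secant_core ::
  "(real \<Rightarrow> real) \<Rightarrow> real \<Rightarrow> (point set \<Rightarrow> bool) \<Rightarrow> point set \<Rightarrow> point set \<Rightarrow> bool"
  for g :: "real \<Rightarrow> real" and \<epsilon> :: real and stop :: "point set \<Rightarrow> bool" where
  finish: "stop Q \<Longrightarrow> secant_core g \<epsilon> stop Q Q"
| query: "\<lbrakk>\<not> stop Q; xq = next_query \<epsilon> Q;
     secant_core g \<epsilon> stop (Q \<union> {(xq, g xq)}) R\<rbrakk> \<Longrightarrow> secant_core g \<epsilon> stop Q R"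

definition qels_stop :: "(real \<Rightarrow> real) \<Rightarrow> real \<Rightarrow> point set \<Rightarrow> bool" where
  "qels_stop g c P \<longleftrightarrow> ereal c * extent (Delta_y P) \<le> ereal (g 0 - y_low P)"

(* qels_loop g \<epsilon> c a i P r: the outer loop entered at round i with point set P returns r,
   where a is the previous step size. *)

inductive qels_loop ::
  "(real \<Rightarrow> real) \<Rightarrow> real \<Rightarrow> real \<Rightarrow> real \<Rightarrow> nat \<Rightarrow> point set \<Rightarrow> real \<Rightarrow> bool"
  for g :: "real \<Rightarrow> real" and \<epsilon> c a :: real where
  finish: "\<lbrakk>xr = 4 ^ i * a; secant_core g \<epsilon> (qels_stop g c) (P \<union> {(xr, g xr)}) P';
     is_low P' p; fst p < xr\<rbrakk> \<Longrightarrow> qels_loop g \<epsilon> c a i P (fst p)"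
| continue: "\<lbrakk>xr = 4 ^ i * a; secant_core g \<epsilon> (qels_stop g c) (P \<union> {(xr, g xr)}) P';
     is_low P' p; \<not> fst p < xr; qels_loop g \<epsilon> c a (Suc i) P' r\<rbrakk> \<Longrightarrow> qels_loop g \<epsilon> c a i P r"

definition quasi_exact_line_search ::
  "(real \<Rightarrow> real) \<Rightarrow> real \<Rightarrow> real \<Rightarrow> real \<Rightarrow> real \<Rightarrow> bool" where
  "quasi_exact_line_search g \<epsilon> c a r \<longleftrightarrow> qels_loop g \<epsilon> c a 0 {(0, g 0)} r"

(* The first k line-search calls have returned; the j-th call returns \<alpha> j, and \<alpha> 0 is the
   initial value of the previous step size.  Nothing is required beyond iteration k. *)

definition gd_qels ::
  "('a::real_inner \<Rightarrow> real) \<Rightarrow> real \<Rightarrow> real \<Rightarrow> nat \<Rightarrow> (nat \<Rightarrow> 'a) \<Rightarrow> (nat \<Rightarrow> real) \<Rightarrow> bool" where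
  "gd_qels f \<epsilon> c k x \<alpha> \<longleftrightarrow> x 1 = x 0 \<and> \<alpha> 0 = 1 \<and>
     (\<forall>j\<in>{1..k}.
        quasi_exact_line_search (\<lambda>a. f (x j - a *\<^sub>R grad f (x j))) \<epsilon> c (\<alpha> (j - 1)) (\<alpha> j) \<and>
        x (j + 1) = x j - \<alpha> j *\<^sub>R grad f (x j))"

end

theory Submission
  imports Defs
begin

text \<open>
  The graph of a convex function lies above each of its secants outside the chord. Hence
  whenever \<open>g\<close> takes a value below \<open>y_low P\<close> at a point spanned by \<open>P\<close>, that point of the graph
  lies in \<open>Delta P\<close>, and so does a lowest point of \<open>P\<close>; the height of \<open>Delta P\<close> thus bounds the
  suboptimality of the lowest point. A line search only returns when the lowest point is to the
  left of the right end of the bracket, and then convexity excludes smaller values beyond that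
  end. With the stopping predicate, a returned step \<open>r\<close> satisfies
  \<open>c (g r - g a) \<le> g 0 - g r\<close> for all \<open>a \<ge> 0\<close>. Taking \<open>a = 1 / M\<close> and combining with the
  Polyak-Lojasiewicz inequality gives the contraction factor of a single iteration.
\<close>

section \<open>Convex functions and their secants\<close>

text \<open>Jensen's inequality with \<open>t\<close> written as a convex combination of
  \<open>s\<close> and \<open>w\<close>, multiplied through by \<open>w - s\<close> to clear the
  denominators.\<close>

lemma convex_on_three_points:
  fixes g :: "real \<Rightarrow> real"
  assumes "convex_on UNIV g" "s < t" "t < w"
  shows "(w - s) * g t \<le> (w - t) * g s + (t - s) * g w"
proof -
  define u where "u = (t - s) / (w - s)"
  have ws: "w - s > 0" using assms by simp
  have u: "0 \<le> u" "u \<le> 1" using assms by (auto simp: u_def)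
  have u_mult: "(w - s) * u = t - s" using ws by (simp add: u_def)
  then have "t = (1 - u) *\<^sub>R s + u *\<^sub>R w" by (simp add: algebra_simps)
  then have "g t \<le> (1 - u) * g s + u * g w"
    using convex_onD[OF assms(1) u, of s w] by simp
  then have "(w - s) * g t \<le> (w - s) * ((1 - u) * g s + u * g w)"
    using ws by (intro mult_left_mono) auto
  also have "\<dots> = ((w - s) - (w - s) * u) * g s + ((w - s) * u) * g w"
    by (simp add: algebra_simps)
  finally show ?thesis using u_mult by simp
qed

text \<open>Outside the chord the nearer endpoint lies between \<open>x\<close> and the other
  endpoint, so the three-point inequality bounds its value from above; solved for
  \<open>g x\<close>, this is the claim. At the endpoints equality holds.\<close>

lemma secant_le_convex:
  assumes "convex_on UNIV g" "u < v" "x \<notin> {u<..<v}"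
  shows "secant (u, g u) (v, g v) x \<le> g x"
proof -
  have "(v - u) * secant (u, g u) (v, g v) x = (g v - g u) * (x - u) + (v - u) * g u"
  proof -
    have "(g u - g v) / (u - v) = (g v - g u) / (v - u)"
      by (metis minus_diff_eq minus_divide_divide)
    then show ?thesis using assms(2) by (simp add: secant_def distrib_left)
  qed
  also have "\<dots> \<le> (v - u) * g x"
  proof -
    consider "x < u" | "x = u" | "x = v" | "v < x" using assms(3) by force
    then show ?thesis
    proof cases
      case 1
      then show ?thesis
        using convex_on_three_points[OF assms(1) 1 assms(2)] by (simp add: algebra_simps)
    next
      case 4
      then show ?thesis
        using convex_on_three_points[OF assms(1) assms(2) 4] by (simp add: algebra_simps)
    qed (auto simp: algebra_simps)
  qed
  finally show ?thesis using assms(2) by simp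
qed

section \<open>Samples spanning an interval, and the region \<open>Delta\<close>\<close>

text \<open>The invariant of both loops. Having both ends in \<open>P\<close> makes the abscissae
  span exactly \<open>{0..X}\<close>, and \<open>X = 0\<close> is allowed.\<close>

definition bracket :: "(real \<Rightarrow> real) \<Rightarrow> real \<Rightarrow> point set \<Rightarrow> bool" where
  "bracket g X P \<longleftrightarrow> finite P \<and> P \<subseteq> (\<lambda>t. (t, g t)) ` {0..X} \<and> (0, g 0) \<in> P \<and> (X, g X) \<in> P"

lemma bracketD:
  assumes "bracket g X P"
  shows "finite P" "P \<noteq> {}" "Min (fst ` P) = 0" "Max (fst ` P) = X"
    "\<And>p. p \<in> P \<Longrightarrow> snd p = g (fst p)" "\<And>p. p \<in> P \<Longrightarrow> fst p \<in> {0..X}"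
  using assms unfolding bracket_def by (force intro!: Min_eqI Max_eqI)+

lemma bracket_extend:
  assumes "bracket g X P" "X \<le> Y"
  shows "bracket g Y (P \<union> {(Y, g Y)})"
  using assms unfolding bracket_def by force

lemma is_lowD:
  assumes "bracket g X P" "is_low P p"
  shows "p \<in> P" "y_low P = g (fst p)" "0 \<le> fst p" "fst p \<le> X"
proof -
  show "p \<in> P" using assms(2) by (simp add: is_low_def is_arg_min_def)
  moreover have "\<forall>q\<in>P. snd p \<le> snd q"
    using assms(2) by (auto simp: is_low_def is_arg_min_def not_less)
  ultimately have "y_low P = snd p"
    unfolding y_low_def using bracketD(1)[OF assms(1)] by (intro Min_eqI) auto
  then show "y_low P = g (fst p)" "0 \<le> fst p" "fst p \<le> X"
    using \<open>p \<in> P\<close> bracketD(5,6)[OF assms(1)] by auto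
qed

lemma y_low_attained:
  assumes "bracket g X P"
  obtains t where "t \<in> {0..X}" "y_low P = g t"
proof -
  have "Min (snd ` P) \<in> snd ` P" using bracketD(1,2)[OF assms] by (intro Min_in) auto
  then obtain p where "p \<in> P" "y_low P = snd p" by (auto simp: y_low_def)
  then show ?thesis using that bracketD(5,6)[OF assms] by metis
qed

lemma graph_in_Delta:
  assumes "convex_on UNIV g" "bracket g X P" "t \<in> {0..X}" "g t \<le> y_low P"
  shows "(t, g t) \<in> Delta P"
proof -
  have "secant p q t \<le> g t"
    if "p \<in> P" "q \<in> P" "fst p < fst q" "t \<notin> {fst p<..<fst q}" for p q
    using secant_le_convex[OF assms(1) that(3,4)] bracketD(5)[OF assms(2)] that
    by (metis prod.collapse)
  then show ?thesis
    using assms(3,4) bracketD(3,4)[OF assms(2)] by (auto simp: Delta_def)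
qed

lemma next_query_in_bracket:
  assumes "convex_on UNIV g" "bracket g X Q" "0 < \<epsilon>" "\<epsilon> < 1 / 2"
  shows "next_query \<epsilon> Q \<in> {0..X}"
proof -
  define l r where "l = Inf (Delta_x Q)" and "r = Sup (Delta_x Q)"
  \<comment> \<open>A lowest sample shows that \<open>Delta_x Q\<close> is nonempty; with
    boundedness this makes \<open>Inf\<close> and \<open>Sup\<close> meaningful.\<close>
  obtain t where "t \<in> {0..X}" "y_low Q = g t"
    using y_low_attained[OF assms(2)] .
  then have t: "t \<in> Delta_x Q"
    using graph_in_Delta[OF assms(1,2), of t] by (auto simp: Delta_x_def)
  have sub: "Delta_x Q \<subseteq> {0..X}"
    using bracketD(3,4)[OF assms(2)] by (auto simp: Delta_x_def Delta_def)
  then have "bdd_below (Delta_x Q)" "bdd_above (Delta_x Q)"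
    by (meson bdd_below_mono bdd_below_Icc, meson bdd_above_mono bdd_above_Icc)
  then have "l \<le> t" "t \<le> r"
    using t by (auto simp: l_def r_def intro: cInf_lower cSup_upper)
  moreover have "0 \<le> l" "r \<le> X"
    using t sub unfolding l_def r_def by (auto intro!: cInf_greatest cSup_least)
  \<comment> \<open>Since \<open>\<epsilon> < 1 / 2\<close>, the shift off the midpoint does not
    pass \<open>r\<close>.\<close>
  moreover have "\<epsilon> * (r - l) \<le> 1 / 2 * (r - l)"
    using calculation assms(4) by (intro mult_right_mono) auto
  moreover have "0 \<le> \<epsilon> * (r - l)"
    using calculation assms(3) by simp
  ultimately show ?thesis
    by (auto simp: next_query_def Let_def simp flip: l_def r_def)
qed

section \<open>Guarantees of the line search\<close>

text \<open>Partial correctness by rule induction: queries stay inside the bracket, so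
  \<open>X\<close> remains fixed, and the only exit is through \<open>stop\<close>.\<close>

lemma secant_core_bracket:
  assumes "secant_core g \<epsilon> stop Q R"
    and "convex_on UNIV g" "bracket g X Q" "0 < \<epsilon>" "\<epsilon> < 1 / 2"
  shows "bracket g X R \<and> stop R"
  using assms
proof (induction rule: secant_core.induct)
  case (query Q xq R)
  then have "xq \<in> {0..X}" using next_query_in_bracket by blast
  then have "bracket g X (Q \<union> {(xq, g xq)})" using query.prems(2) by (auto simp: bracket_def)
  then show ?case using query by blast
qed simp

lemma qels_stop_bound:
  assumes g: "convex_on UNIV g" and P: "bracket g X P" and stop: "qels_stop g c P"
    and p: "is_low P p" "fst p < X" and "0 < c" "0 \<le> t"
  shows "c * (g (fst p) - g t) \<le> g 0 - g (fst p)"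
proof -
  note low = is_lowD[OF P p(1)]
  have "(0, g 0) \<in> P" using P by (simp add: bracket_def)
  moreover have "(X, g X) \<in> P" using P by (simp add: bracket_def)
  ultimately have low_le: "g (fst p) \<le> g 0" "g (fst p) \<le> g X"
    using bracketD(1)[OF P] low(2) unfolding y_low_def
    by (metis Min_le finite_imageI image_eqI snd_conv)+
  show ?thesis
  proof (cases "g (fst p) \<le> g t")
    case True
    then have "c * (g (fst p) - g t) \<le> 0" using \<open>0 < c\<close> by (simp add: mult_nonneg_nonpos)
    then show ?thesis using low_le by simp
  next
    case False
    \<comment> \<open>Otherwise \<open>X\<close> lies strictly between \<open>fst p\<close> and
      \<open>t\<close>. As \<open>g t < g (fst p)\<close>, convexity would force
      \<open>g X < g (fst p)\<close>, against \<open>p\<close> being lowest.\<close>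
    have "t \<le> X"
    proof (rule ccontr)
      assume "\<not> t \<le> X"
      then have "(t - fst p) * g X \<le> (t - X) * g (fst p) + (X - fst p) * g t"
        using p(2) by (intro convex_on_three_points[OF g]) auto
      moreover have "(X - fst p) * g t < (X - fst p) * g (fst p)"
        using p(2) False by simp
      moreover have "(t - fst p) * g (fst p) \<le> (t - fst p) * g X"
        using low_le p(2) \<open>\<not> t \<le> X\<close> by (intro mult_left_mono) auto
      ultimately show False by (simp add: algebra_simps)
    qed
    then have "g t \<in> Delta_y P" "g (fst p) \<in> Delta_y P"
      using graph_in_Delta[OF g P, of t] graph_in_Delta[OF g P, of "fst p"] False low \<open>0 \<le> t\<close>
      by (auto simp: Delta_y_def)
    \<comment> \<open>Two members of \<open>Delta_y P\<close> bound its extent from below, whether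
      or not the set is bounded.\<close>
    then have "ereal (g (fst p)) - ereal (g t) \<le> extent (Delta_y P)"
      unfolding extent_def by (intro ereal_minus_mono SUP_upper INF_lower)
    then have "ereal c * ereal (g (fst p) - g t) \<le> ereal c * extent (Delta_y P)"
      using \<open>0 < c\<close> by (intro ereal_mult_left_mono) auto
    also have "\<dots> \<le> ereal (g 0 - g (fst p))"
      using stop low(2) by (simp add: qels_stop_def)
    finally show ?thesis by simp
  qed
qed

text \<open>The invariant is stated after insertion of the right end, because on entry to a round
  \<open>P\<close> need not reach \<open>4 ^ i * a\<close> yet.\<close>

lemma qels_loop_bound:
  assumes "qels_loop g \<epsilon> c a i P r"
    and "convex_on UNIV g" "0 < \<epsilon>" "\<epsilon> < 1 / 2" "0 < c" "0 \<le> a"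
    and "bracket g (4 ^ i * a) (P \<union> {(4 ^ i * a, g (4 ^ i * a))})"
  shows "0 \<le> r \<and> (\<forall>t\<ge>0. c * (g r - g t) \<le> g 0 - g r)"
  using assms
proof (induction rule: qels_loop.induct)
  case (finish xr i P P' p)
  then have "bracket g xr P'" "qels_stop g c P'"
    using secant_core_bracket by blast+
  then show ?case
    using is_lowD(3) qels_stop_bound finish by blast
next
  case (continue xr i P P' p r)
  then have "bracket g xr P'"
    using secant_core_bracket by blast
  moreover have "xr \<le> 4 ^ Suc i * a" using continue by simp
  ultimately show ?case
    using continue.IH continue.prems bracket_extend by blast
qed

lemma quasi_exact_line_search_bound:
  assumes "quasi_exact_line_search g \<epsilon> c a r"
    and "convex_on UNIV g" "0 < \<epsilon>" "\<epsilon> < 1 / 2" "0 < c" "0 \<le> a"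
  shows "0 \<le> r" "\<And>t. 0 \<le> t \<Longrightarrow> c * (g r - g t) \<le> g 0 - g r"
proof -
  have "bracket g (4 ^ 0 * a) ({(0, g 0)} \<union> {(4 ^ 0 * a, g (4 ^ 0 * a))})"
    using \<open>0 \<le> a\<close> by (auto simp: bracket_def)
  then show "0 \<le> r" "\<And>t. 0 \<le> t \<Longrightarrow> c * (g r - g t) \<le> g 0 - g r"
    using qels_loop_bound assms unfolding quasi_exact_line_search_def by blast+
qed

section \<open>Strong convexity and smoothness\<close>

lemma strongly_convex_imp_convex_on:
  assumes "strongly_convex m f" "0 \<le> m"
  shows "convex_on UNIV f"
proof (intro convex_onI)
  fix u :: real and y z :: 'a
  assume u: "0 < u" "u < 1"
  define w where "w = (1 - u) *\<^sub>R y + u *\<^sub>R z"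
  have tangent: "f w + (v - w) \<bullet> grad f w \<le> f v" for v
  proof -
    have "f w + (v - w) \<bullet> grad f w + m / 2 * (norm (v - w))\<^sup>2 \<le> f v"
      using assms(1) by (simp add: strongly_convex_def)
    moreover have "0 \<le> m / 2 * (norm (v - w))\<^sup>2" using assms(2) by simp
    ultimately show ?thesis by linarith
  qed
  \<comment> \<open>In the weighted average of the tangent bounds at \<open>w\<close>, the linear
    terms cancel.\<close>
  have "(1 - u) *\<^sub>R (y - w) + u *\<^sub>R (z - w) = 0"
    by (simp add: w_def algebra_simps)
  then have "(1 - u) * ((y - w) \<bullet> grad f w) + u * ((z - w) \<bullet> grad f w) = 0"
    by (metis inner_add_left inner_scaleR_left inner_zero_left)
  moreover have "(1 - u) * (f w + (y - w) \<bullet> grad f w) \<le> (1 - u) * f y"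
    using u tangent by (intro mult_left_mono) auto
  moreover have "u * (f w + (z - w) \<bullet> grad f w) \<le> u * f z"
    using u tangent by (intro mult_left_mono) auto
  ultimately show "f ((1 - u) *\<^sub>R y + u *\<^sub>R z) \<le> (1 - u) * f y + u * f z"
    unfolding w_def[symmetric] by (simp add: algebra_simps)
qed simp

lemma convex_on_line:
  assumes "convex_on UNIV f"
  shows "convex_on UNIV (\<lambda>t::real. f (y - t *\<^sub>R v))"
proof (intro convex_onI)
  fix u s t :: real
  assume "0 < u" "u < 1"
  moreover have "y - ((1 - u) *\<^sub>R s + u *\<^sub>R t) *\<^sub>R v
      = (1 - u) *\<^sub>R (y - s *\<^sub>R v) + u *\<^sub>R (y - t *\<^sub>R v)"
    by (simp add: algebra_simps)
  ultimately show "f (y - ((1 - u) *\<^sub>R s + u *\<^sub>R t) *\<^sub>R v)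
      \<le> (1 - u) * f (y - s *\<^sub>R v) + u * f (y - t *\<^sub>R v)"
    using convex_onD[OF assms, of u] by simp
qed simp

text \<open>The Polyak-Lojasiewicz inequality, with an arbitrary point \<open>z\<close> in place of
  the minimizer.\<close>

lemma strongly_convex_PL:
  assumes "strongly_convex m f" "m > 0"
  shows "2 * m * (f y - f z) \<le> (norm (grad f y))\<^sup>2"
proof -
  have "f y + (z - y) \<bullet> grad f y + m / 2 * (norm (z - y))\<^sup>2 \<le> f z"
    using assms(1) by (simp add: strongly_convex_def)
  then have "(2 * m) * (f y + (z - y) \<bullet> grad f y + m / 2 * (norm (z - y))\<^sup>2) \<le> (2 * m) * f z"
    using assms(2) by (intro mult_left_mono) auto
  \<comment> \<open>Completing the square: this vector vanishes exactly where the quadratic lower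
    bound, as a function of \<open>z\<close>, is smallest.\<close>
  moreover have "0 \<le> (norm (m *\<^sub>R (z - y) + grad f y))\<^sup>2" by simp
  then have "0 \<le> m\<^sup>2 * (norm (z - y))\<^sup>2 + 2 * m * ((z - y) \<bullet> grad f y) + (norm (grad f y))\<^sup>2"
    unfolding power2_norm_eq_inner inner_add_left inner_add_right
    by (simp add: power2_eq_square inner_commute)
  ultimately show ?thesis
    by (simp add: algebra_simps power2_eq_square)
qed

text \<open>The step \<open>1 / M\<close> minimizes the quadratic upper bound along the negative
  gradient.\<close>

lemma smooth_gradient_step:
  assumes "smooth M f" "M > 0"
  shows "f (y - (1 / M) *\<^sub>R grad f y) \<le> f y - (norm (grad f y))\<^sup>2 / (2 * M)"
proof -
  let ?z = "y - (1 / M) *\<^sub>R grad f y"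
  have "f ?z \<le> f y + (?z - y) \<bullet> grad f y + M / 2 * (norm (?z - y))\<^sup>2"
    using assms(1) unfolding smooth_def by blast
  also have "\<dots> = f y - (norm (grad f y))\<^sup>2 / (2 * M)"
    using assms(2) by (simp add: dot_square_norm power_divide) (simp add: field_simps power2_eq_square)
  finally show ?thesis .
qed

text \<open>The two quadratic bounds are compared at a unit displacement, which exists because
  \<open>Basis\<close> is nonempty.\<close>

lemma strongly_convex_smooth_le:
  fixes f :: "'a::euclidean_space \<Rightarrow> real"
  assumes "strongly_convex m f" "smooth M f"
  shows "m \<le> M"
proof -
  obtain b :: 'a where "norm b = 1" using norm_Basis nonempty_Basis by blast
  moreover have "f 0 + (b - 0) \<bullet> grad f 0 + m / 2 * (norm (b - 0))\<^sup>2 \<le> f b"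
    "f b \<le> f 0 + (b - 0) \<bullet> grad f 0 + M / 2 * (norm (b - 0))\<^sup>2"
    using assms unfolding strongly_convex_def smooth_def by blast+
  ultimately show ?thesis by simp
qed

section \<open>Convergence of the iteration\<close>

text \<open>Each returned step is the first bracket length of the next call, whose guarantee needs
  it to be nonnegative; the chain starts at \<open>\<alpha> 0 = 1\<close>.\<close>

lemma gd_qels_step_nonneg:
  assumes "gd_qels f \<epsilon> c k x \<alpha>" "convex_on UNIV f" "0 < \<epsilon>" "\<epsilon> < 1 / 2" "0 < c"
    and "j \<le> k"
  shows "0 \<le> \<alpha> j"
  using \<open>j \<le> k\<close>
proof (induction j)
  case 0
  then show ?case using assms(1) by (simp add: gd_qels_def)
next
  case (Suc j)
  then have "quasi_exact_line_search
      (\<lambda>a. f (x (Suc j) - a *\<^sub>R grad f (x (Suc j)))) \<epsilon> c (\<alpha> j) (\<alpha> (Suc j))"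
    using assms(1) by (force simp: gd_qels_def)
  then show ?case
    using quasi_exact_line_search_bound(1) convex_on_line assms Suc by (metis Suc_leD)
qed

lemma gd_qels_contraction:
  assumes qels: "quasi_exact_line_search (\<lambda>a. f (y - a *\<^sub>R grad f y)) \<epsilon> c a r"
    and sc: "strongly_convex m f" and sm: "smooth M f" and "m > 0" "M > 0"
    and c: "0 < \<epsilon>" "\<epsilon> < 1 / 2" "0 < c" and "0 \<le> a"
  shows "f (y - r *\<^sub>R grad f y) - f z \<le> (1 - c / (c + 1) * (m / M)) * (f y - f z)"
proof -
  let ?d = "f y - f (y - r *\<^sub>R grad f y)" and ?G = "(norm (grad f y))\<^sup>2"
  have "convex_on UNIV f" using strongly_convex_imp_convex_on[OF sc] \<open>m > 0\<close> by simp
  then have "c * (f (y - r *\<^sub>R grad f y) - f (y - (1 / M) *\<^sub>R grad f y)) \<le> ?d"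
    using quasi_exact_line_search_bound(2)[OF qels convex_on_line c \<open>0 \<le> a\<close>, of "1 / M"]
      \<open>M > 0\<close> by simp
  \<comment> \<open>Adding \<open>c * ?d\<close> to both sides compares decreases: the search
    achieves at least the fraction \<open>c / (c + 1)\<close> of the decrease of the step
    \<open>1 / M\<close>.\<close>
  then have "c * (f y - f (y - (1 / M) *\<^sub>R grad f y)) \<le> (c + 1) * ?d"
    by (simp add: algebra_simps)
  moreover have "m / M * (f y - f z) \<le> f y - f (y - (1 / M) *\<^sub>R grad f y)"
  proof -
    have "m / M * (f y - f z) = 2 * m * (f y - f z) / (2 * M)" by simp
    also have "\<dots> \<le> ?G / (2 * M)"
      using strongly_convex_PL[OF sc \<open>m > 0\<close>] \<open>M > 0\<close> by (intro divide_right_mono) auto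
    finally show ?thesis using smooth_gradient_step[OF sm \<open>M > 0\<close>, of y] by linarith
  qed
  then have "c * (m / M * (f y - f z)) \<le> c * (f y - f (y - (1 / M) *\<^sub>R grad f y))"
    using c by (intro mult_left_mono) auto
  ultimately have "c * (m / M * (f y - f z)) \<le> ?d * (c + 1)" by (simp add: mult.commute)
  then have "c * (m / M * (f y - f z)) / (c + 1) \<le> ?d"
    using c by (subst pos_divide_le_eq) auto
  then have "c / (c + 1) * (m / M) * (f y - f z) \<le> ?d" by (simp add: mult_ac)
  then show ?thesis unfolding left_diff_distrib[of 1] mult_1 by argo
qed

theorem theorem13:
  fixes f :: "'a::euclidean_space \<Rightarrow> real" and m M c \<epsilon> :: real
    and xstar :: 'a and x :: "nat \<Rightarrow> 'a" and \<alpha> :: "nat \<Rightarrow> real" and k :: nat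
  assumes "m > 0" and "M > 0"
    and "strongly_convex m f" and "smooth M f"
    and "\<forall>y. f xstar \<le> f y"
    and "c > 0" and "0 < \<epsilon>" and "\<epsilon> < 1 / 2"
    and "gd_qels f \<epsilon> c k x \<alpha>"
  shows "f (x (k + 1)) - f xstar \<le> (f (x 1) - f xstar) * (1 - c / (c + 1) * (m / M)) ^ k"
proof -
  define q where "q = 1 - c / (c + 1) * (m / M)"
  \<comment> \<open>This gives \<open>0 \<le> q\<close>, so that the induction hypothesis can be
    multiplied by \<open>q\<close>.\<close>
  have "m / M \<le> 1" using strongly_convex_smooth_le assms(2-4) by (simp add: pos_divide_le_eq)
  then have "c / (c + 1) * (m / M) \<le> 1 * 1"
    using assms(1,2,6) by (intro mult_mono) auto
  then have "0 \<le> q" by (simp add: q_def)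
  have conv: "convex_on UNIV f" using strongly_convex_imp_convex_on assms(1,3) by fastforce
  \<comment> \<open>The induction runs over \<open>j \<le> k\<close> with \<open>k\<close> fixed,
    since \<open>gd_qels\<close> constrains nothing beyond iteration \<open>k\<close>.\<close>
  have "f (x (j + 1)) - f xstar \<le> (f (x 1) - f xstar) * q ^ j" if "j \<le> k" for j
    using that
  proof (induction j)
    case (Suc j)
    have "quasi_exact_line_search
        (\<lambda>a. f (x (Suc j) - a *\<^sub>R grad f (x (Suc j)))) \<epsilon> c (\<alpha> j) (\<alpha> (Suc j))"
      and step: "x (Suc j + 1) = x (Suc j) - \<alpha> (Suc j) *\<^sub>R grad f (x (Suc j))"
      using assms(9) Suc.prems by (force simp: gd_qels_def)+
    moreover have "0 \<le> \<alpha> j"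
      using gd_qels_step_nonneg[OF assms(9) conv] assms Suc.prems by simp
    ultimately have "f (x (Suc j + 1)) - f xstar \<le> q * (f (x (Suc j)) - f xstar)"
      unfolding step q_def using assms(1-4,6-8) by (intro gd_qels_contraction)
    also have "\<dots> \<le> q * ((f (x 1) - f xstar) * q ^ j)"
      using Suc \<open>0 \<le> q\<close> by (intro mult_left_mono) auto
    finally show ?case by (simp add: mult_ac)
  qed simp
  then show ?thesis by (simp add: q_def)
qed

end
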